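(* The optimal policy has a bang-bang structure if $$\frac{r(s)}{f(s)}\le\frac{r(\bar s)}{f(\bar s)}\qquad\text{for all } s\in(0,\bar s).$$ That is, under this condition the optimal production rate in every state $(x,t)$ can be taken in $\{0,\bar s\}$.
   Context: "Increasing" and "decreasing" are meant in the weak sense throughout. Model. A system has deterioration level in $\mathscr{X}=\{0,1,\ldots,\xi\}$, where $\xi\in\mathbb{N}$ is the failure level. The decision maker continuously chooses a production rate $s\in\mathscr{S}=[0,\bar s]$, $0<\bar s<\infty$. Under rate $s$, revenue accrues at rate $r(s)$ and the deterioration level jumps up by one according to a Poisson process with instantaneous intensity $\lambda f(s)$, where $\lambda\ge 0$ is the base rate. The deterioration function $f:\mathscr{S}\to\mathbb{R}_+$ and the revenue function $r:\mathscr{S}\to\mathbb{R}$ are continuous and increasing, with $f(0)=0$ and $r(0)\le 0$. The maintenance cost function $c_m:\mathscr{X}\to\mathbb{R}_+$ is increasing and convex. Time is indexed backwards: $t$ denotes the remaining time to the planned maintenance moment, which occurs at $t=0$, and $X_k$ is the deterioration level when $k$ time units remain. $\mathscr{U}$ is the set of non-anticipating production policies under which, almost surely, the deterioration level never exceeds $\xi$; in particular, the system is turned off ($s=0$) once it has reached level $\xi$. For $u\in\mathscr{U}$, with induced production rate $s^u_\lambda(x,k)$ at level $x$ and remaining time $k$, $$J^u_\lambda(x,t)=\mathbb{E}_u\Big[\int_0^t r\big(s^u_\lambda(X_k,k)\big)\,dk-c_m(X_0)\ \Big|\ X_t=x\Big],\qquad J^*_\lambda(x,t)=\sup_{u\in\mathscr{U}}J^u_\lambda(x,t).$$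 Write $\Delta_\lambda(x,t)=J^*_\lambda(x,t)-J^*_\lambda(x+1,t)$ for $x\in\{0,\ldots,\xi-1\}$. The optimal production rate in state $(x,t)$ is, for $x\le\xi-1$, a solution of $\max_{s\in\mathscr{S}}\big[r(s)-\lambda f(s)\Delta_\lambda(x,t)\big]$, and is $0$ for $x=\xi$. A bang-bang production policy is a policy in which production is always either set to the maximum rate $s=\bar s$ or turned off, $s=0$. The ratios in the condition are understood with nonzero denominators.
   Formalization: When r(0) < 0 the claim as stated fails (f(s)=s, r(s)=min(2s-1,0), s̄=λ=ξ=1, c_m(x)=x, state (0,0)); in that case it is additionally assumed that (r(s)-r(0))/f(s) ≤ (r(s̄)-r(0))/f(s̄) for all s in (0,s̄). For r(0)=0 nothing is added. *)

theory Defs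
  imports "HOL-Probability.Probability"
begin

text \<open>
  A production policy gives the rate as a function \<open>u x n h k\<close> of the observed past: the
  initial level \<open>x\<close>, the number \<open>n\<close> of jumps so far (the current level is \<open>x + n\<close>), the
  history \<open>h\<close>, and the remaining time \<open>k\<close>. Here \<open>h 0\<close> is the remaining time at the start and
  \<open>h i\<close> the remaining time at the \<open>i\<close>-th jump, for \<open>1 \<le> i \<le> n\<close>.
\<close>

type_synonym policy = "nat \<Rightarrow> nat \<Rightarrow> (nat \<Rightarrow> real) \<Rightarrow> real \<Rightarrow> real"

locale production_system =
  fixes \<xi> :: nat and sbar lam :: real and f r :: "real \<Rightarrow> real" and c\<^sub>m :: "nat \<Rightarrow> real"
  assumes sbar_pos: "0 < sbar"
    and lam_nonneg: "0 \<le> lam"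
    and f_nonneg: "\<And>s. s \<in> {0..sbar} \<Longrightarrow> 0 \<le> f s"
    and f_cont: "continuous_on {0..sbar} f"
    and f_mono: "mono_on {0..sbar} f"
    and f_zero: "f 0 = 0"
    and r_cont: "continuous_on {0..sbar} r"
    and r_mono: "mono_on {0..sbar} r"
    and r_zero: "r 0 \<le> 0"
    and c\<^sub>m_nonneg: "\<And>x. x \<le> \<xi> \<Longrightarrow> 0 \<le> c\<^sub>m x"
    and c\<^sub>m_mono: "mono_on {..\<xi>} c\<^sub>m"
    and c\<^sub>m_convex: "\<And>x. x + 2 \<le> \<xi> \<Longrightarrow> c\<^sub>m (x + 1) - c\<^sub>m x \<le> c\<^sub>m (x + 2) - c\<^sub>m (x + 1)"
begin

text \<open>
  The jump process with intensity \<open>lam * f s\<close> is built from independent unit exponential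
  variables \<open>w 0, w 1, \<dots>\<close>: jump \<open>n + 1\<close> occurs as soon as the intensity accumulated since
  jump \<open>n\<close> reaches \<open>w n\<close>.
\<close>

definition noise :: "(nat \<Rightarrow> real) measure" where
  "noise = PiM UNIV (\<lambda>_. density lborel (exponential_density 1))"

text \<open>Time runs backwards, hence \<open>Sup\<close>; the value \<open>-1\<close> stands for a jump that does not occur
  before the maintenance moment.\<close>

definition next_jump :: "policy \<Rightarrow> nat \<Rightarrow> nat \<Rightarrow> (nat \<Rightarrow> real) \<Rightarrow> real \<Rightarrow> real" where
  "next_jump u x n h e =
     Sup (insert (-1) {k \<in> {0..h n}. e \<le> (LINT v:{k..h n}|lborel. lam * f (u x n h v))})"

primrec history :: "policy \<Rightarrow> nat \<Rightarrow> real \<Rightarrow> (nat \<Rightarrow> real) \<Rightarrow> nat \<Rightarrow> nat \<Rightarrow> real" where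
  "history u x t w 0 = (\<lambda>i\<in>{0}. t)"
| "history u x t w (Suc n) =
     (history u x t w n)(Suc n := next_jump u x n (history u x t w n) (w n))"

definition num_jumps :: "policy \<Rightarrow> nat \<Rightarrow> real \<Rightarrow> (nat \<Rightarrow> real) \<Rightarrow> real \<Rightarrow> nat" where
  "num_jumps u x t w k = card {n. k \<le> history u x t w (Suc n) (Suc n)}"

definition level :: "policy \<Rightarrow> nat \<Rightarrow> real \<Rightarrow> (nat \<Rightarrow> real) \<Rightarrow> real \<Rightarrow> nat" where
  "level u x t w k = x + num_jumps u x t w k"

definition rate :: "policy \<Rightarrow> nat \<Rightarrow> real \<Rightarrow> (nat \<Rightarrow> real) \<Rightarrow> real \<Rightarrow> real" where
  "rate u x t w k = (let n = num_jumps u x t w k in u x n (history u x t w n) k)"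

text \<open>Non-anticipation is built in: the history passed to \<open>u x n\<close> is supported on \<open>{..n}\<close>.\<close>

definition policies :: "policy set" where
  "policies = {u.
     (\<forall>x n h k. u x n h k \<in> {0..sbar}) \<and>
     (\<forall>x n. (\<lambda>(h, k). u x n h k) \<in> borel_measurable (PiM {..n} (\<lambda>_. borel) \<Otimes>\<^sub>M borel)) \<and>
     (\<forall>x n h k. x + n = \<xi> \<longrightarrow> u x n h k = 0) \<and>
     (\<forall>x\<le>\<xi>. \<forall>t\<ge>0. AE w in noise. \<forall>k\<in>{0..t}. level u x t w k \<le> \<xi>)}"

definition J :: "policy \<Rightarrow> nat \<Rightarrow> real \<Rightarrow> real" where
  "J u x t =
     (LINT w|noise. (LINT k:{0..t}|lborel. r (rate u x t w k)) - c\<^sub>m (level u x t w 0))"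

definition J_opt :: "nat \<Rightarrow> real \<Rightarrow> real" where
  "J_opt x t = (SUP u\<in>policies. J u x t)"

definition \<Delta> :: "nat \<Rightarrow> real \<Rightarrow> real" where
  "\<Delta> x t = J_opt x t - J_opt (x + 1) t"

definition optimal_rate :: "nat \<Rightarrow> real \<Rightarrow> real \<Rightarrow> bool" where
  "optimal_rate x t s \<longleftrightarrow>
     (if x = \<xi> then s = 0
      else is_arg_max (\<lambda>s. r s - lam * f s * \<Delta> x t) (\<lambda>s. s \<in> {0..sbar}) s)"

end

end

theory Submission
  imports Defs
begin

text \<open>
  The objective is bang-bang for every value \<open>D\<close> of \<open>\<Delta>\<close>. If \<open>R\<close> is the slope
  \<open>(r sbar - r 0) / f sbar\<close>, then the gain of rate \<open>s\<close> over rate \<open>0\<close> is at most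
  \<open>f s * (R - lam * D)\<close>, with equality at \<open>s = sbar\<close>. As \<open>0 \<le> f s \<le> f sbar\<close>, the rate \<open>0\<close> is
  optimal if \<open>R \<le> lam * D\<close>, and \<open>sbar\<close> is optimal otherwise.
\<close>

lemma bang_bang_arg_max:
  fixes f r :: "real \<Rightarrow> real" and b d :: real
  assumes "0 \<le> b" "f 0 = 0"
    and f_pos: "\<And>s. s \<in> {0<..b} \<Longrightarrow> 0 < f s"
    and f_le: "\<And>s. s \<in> {0<..b} \<Longrightarrow> f s \<le> f b"
    and ratio: "\<And>s. s \<in> {0<..<b} \<Longrightarrow> (r s - r 0) / f s \<le> (r b - r 0) / f b"
  shows "\<exists>s\<in>{0, b}. is_arg_max (\<lambda>s. r s - f s * d) (\<lambda>s. s \<in> {0..b}) s"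
proof -
  define R where "R = (r b - r 0) / f b"
  \<comment> \<open>For \<open>b = 0\<close> both sides equal \<open>r 0\<close>, as
    \<open>f b = 0\<close>; otherwise \<open>f b\<close> is positive and cancels.\<close>
  have at_b: "r b - f b * d = r 0 + f b * (R - d)"
    using assms(1,2) f_pos[of b] by (cases "b = 0") (auto simp: R_def field_simps)
  have gain: "r s - f s * d \<le> r 0 + f s * (R - d)" if "s \<in> {0..b}" for s
  proof (cases "s = 0 \<or> s = b")
    case True
    then show ?thesis using at_b assms(2) by auto
  next
    case False
    then have "0 < f s" "(r s - r 0) / f s \<le> R"
      using that f_pos[of s] ratio[of s] by (auto simp: R_def)
    then show ?thesis
      by (simp add: pos_divide_le_eq algebra_simps)
  qed
  have f_range: "0 \<le> f s \<and> f s \<le> f b" if "s \<in> {0..b}" for s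
    using that assms(2) f_pos[of s] f_le[of s] f_pos[of b] by (cases "s = 0"; cases "b = 0") auto
  show ?thesis
  proof (cases "R \<le> d")
    case True
    have "r s - f s * d \<le> r 0 - f 0 * d" if "s \<in> {0..b}" for s
      using gain[OF that] f_range[OF that] True assms(2) mult_nonneg_nonpos[of "f s" "R - d"]
      by simp
    then show ?thesis
      using assms(1) by (auto simp: is_arg_max_def not_less)
  next
    case False
    have "r s - f s * d \<le> r b - f b * d" if "s \<in> {0..b}" for s
    proof -
      have "f s * (R - d) \<le> f b * (R - d)"
        using f_range[OF that] False by (intro mult_right_mono) auto
      then show ?thesis
        using gain[OF that] at_b by linarith
    qed
    then show ?thesis
      using assms(1) by (auto simp: is_arg_max_def not_less)
  qed
qed

text \<open>Every rate competes with rate 0, which earns \<open>r 0\<close>. If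
  \<open>r 0 < 0\<close>, bounding \<open>r s / f s\<close> alone does not control the gain
  \<open>r s - r 0\<close>, so the ratio condition is then also imposed on revenues shifted by
  \<open>r 0\<close>.\<close>

theorem proposition5:
  fixes \<xi> :: nat and sbar lam :: real and f r :: "real \<Rightarrow> real" and c\<^sub>m :: "nat \<Rightarrow> real"
  assumes "production_system \<xi> sbar lam f r c\<^sub>m"
    and "\<And>s. s \<in> {0<..sbar} \<Longrightarrow> f s \<noteq> 0"
    and "\<And>s. s \<in> {0<..<sbar} \<Longrightarrow> r s / f s \<le> r sbar / f sbar"
    and "\<And>s. r 0 < 0 \<Longrightarrow> s \<in> {0<..<sbar} \<Longrightarrow> (r s - r 0) / f s \<le> (r sbar - r 0) / f sbar"
  shows "\<forall>x\<in>{0..\<xi>}. \<forall>t\<ge>0. \<exists>s\<in>{0, sbar}.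
           production_system.optimal_rate \<xi> sbar lam f r c\<^sub>m x t s"
proof (intro ballI allI impI)
  fix x :: nat and t :: real
  interpret production_system \<xi> sbar lam f r c\<^sub>m by (fact assms(1))
  have "0 < f s" if "s \<in> {0<..sbar}" for s
    using f_nonneg[of s] assms(2)[OF that] that by auto
  moreover have "f s \<le> f sbar" if "s \<in> {0<..sbar}" for s
    using mono_onD[OF f_mono, of s sbar] that by auto
  \<comment> \<open>Since \<open>r 0 \<le> 0\<close>, the other case is \<open>r 0 = 0\<close>,
    where shifted and plain ratios coincide.\<close>
  moreover have "(r s - r 0) / f s \<le> (r sbar - r 0) / f sbar" if "s \<in> {0<..<sbar}" for s
    using assms(3,4)[of s] r_zero that by (cases "r 0 < 0") auto
  ultimately have
    "\<exists>s\<in>{0, sbar}. is_arg_max (\<lambda>s. r s - f s * (lam * \<Delta> x t)) (\<lambda>s. s \<in> {0..sbar}) s"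
    using sbar_pos f_zero by (intro bang_bang_arg_max) auto
  \<comment> \<open>At the failure level \<open>\<xi>\<close> the witness is 0, the only rate
    allowed there.\<close>
  then show "\<exists>s\<in>{0, sbar}. optimal_rate x t s"
    by (auto simp: optimal_rate_def mult_ac)
qed

end
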